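(* Let $K$ be a compact subset of $\mathbb{C}$ such that $\mathbb{C}\setminus K$ is connected and $K$ has no interior points. Let $f:K\to\mathbb{C}$ be continuous. Then for every $\epsilon>0$ there exists a polynomial $p(z)$ with complex coefficients such that $p(z)\neq 0$ for all $z\in K$ and $$|p(z)-f(z)|<\epsilon \quad \text{for all } z\in K.$$ *)

theory Defs
  imports "HOL-Analysis.Analysis" "HOL-Computational_Algebra.Polynomial"
begin

end

theory Submission
  imports Defs "HOL-Complex_Analysis.Cauchy_Integral_Formula"
    "HOL-Computational_Algebra.Fundamental_Theorem_Algebra" "HOL-Real_Asymp.Real_Asymp"
begin

text \<open>
  The core is Lavrentiev's theorem that polynomials are dense in \<open>C(K)\<close>. By Stone-Weierstrass it
  suffices to approximate \<open>Im z\<close>. Up to a function holomorphic near \<open>K\<close>, \<open>- 2 \<pi> \<i> Im z\<close> is the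
  Cauchy transform of area measure on a large square, hence nearly the sum of \<open>d\<^sup>2 / (z - c)\<close> over a
  grid of points \<open>c\<close> of mesh \<open>d\<close>. Since \<open>K\<close> has empty interior and connected complement, some path
  off \<open>K\<close> of diameter comparable to \<open>d\<close> lies near \<open>c\<close>. With its endpoints \<open>p, q\<close>, the function
  \<open>2 z - p - q - 2 sqrt ((z - p) (z - q))\<close> has a single-valued branch off the path and, suitably
  scaled, replaces \<open>1 / (z - c)\<close>: it is \<open>O(1 / d)\<close> near \<open>c\<close> and differs from \<open>1 / (z - c)\<close> by
  \<open>O(d / |z - c|\<^sup>2)\<close> elsewhere. The total error is \<open>O(d log\<^sup>2 (1 / d))\<close>. The square root is built
  from exponentials and logarithms of functions with poles off \<open>K\<close>, which are limits of polynomials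
  by pushing the poles to infinity.

  A polynomial is made zero-free on \<open>K\<close> by moving its roots slightly, as the complement of \<open>K\<close> is
  dense.
\<close>

subsection \<open>Uniform limits of polynomials\<close>

text \<open>Membership in the uniform algebra \<open>P(K)\<close>, the sup-norm closure of the
  polynomials on \<open>K\<close>; only the values of \<open>f\<close> on \<open>K\<close> matter.
  The closure properties below say that this is a closed algebra.\<close>

definition poly_approximable :: "complex set \<Rightarrow> (complex \<Rightarrow> complex) \<Rightarrow> bool" where
  "poly_approximable K f \<longleftrightarrow>
     (\<forall>e>0. \<exists>p :: complex poly. \<forall>z\<in>K. cmod (poly p z - f z) < e)"

lemma poly_approximable_poly: "poly_approximable K (poly p)"
  unfolding poly_approximable_def by (intro allI impI exI[of _ p]) simp

lemma poly_approximable_const: "poly_approximable K (\<lambda>z. c)"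
  using poly_approximable_poly[of K "[:c:]"] by (simp add: fun_eq_iff poly_approximable_def)

lemma poly_approximable_ident: "poly_approximable K (\<lambda>z. z)"
  using poly_approximable_poly[of K "[:0, 1:]"] by (simp add: poly_approximable_def)

lemma poly_approximable_cong:
  assumes "poly_approximable K f" "\<And>z. z \<in> K \<Longrightarrow> f z = g z"
  shows "poly_approximable K g"
  using assms unfolding poly_approximable_def by metis

lemma poly_approximable_limit:
  assumes "\<And>e. e > 0 \<Longrightarrow> \<exists>g. poly_approximable K g \<and> (\<forall>z\<in>K. cmod (g z - f z) \<le> e)"
  shows "poly_approximable K f"
  unfolding poly_approximable_def
proof (intro allI impI)
  fix e :: real assume e: "e > 0"
  then obtain g where g: "poly_approximable K g" "\<forall>z\<in>K. cmod (g z - f z) \<le> e/2"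
    using assms[of "e/2"] by auto
  then obtain p :: "complex poly" where p: "\<forall>z\<in>K. cmod (poly p z - g z) < e/2"
    using e unfolding poly_approximable_def by (meson half_gt_zero)
  have "cmod (poly p z - f z) < e" if "z \<in> K" for z
    using norm_triangle_ineq[of "poly p z - g z" "g z - f z"] g(2) p that by fastforce
  then show "\<exists>p. \<forall>z\<in>K. cmod (poly p z - f z) < e" by blast
qed

lemma poly_approximable_add:
  assumes "poly_approximable K f" "poly_approximable K g"
  shows "poly_approximable K (\<lambda>z. f z + g z)"
  unfolding poly_approximable_def
proof (intro allI impI)
  fix e :: real assume e: "e > 0"
  obtain p q :: "complex poly" where pq: "\<forall>z\<in>K. cmod (poly p z - f z) < e/2" "\<forall>z\<in>K. cmod (poly q z - g z) < e/2"
    using assms e unfolding poly_approximable_def by (meson half_gt_zero)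
  have "cmod (poly (p + q) z - (f z + g z)) < e" if "z \<in> K" for z
  proof -
    have "poly (p + q) z - (f z + g z) = (poly p z - f z) + (poly q z - g z)" by simp
    then have "cmod (poly (p + q) z - (f z + g z)) \<le> cmod (poly p z - f z) + cmod (poly q z - g z)"
      by (metis norm_triangle_ineq)
    then show ?thesis using pq that by fastforce
  qed
  then show "\<exists>p. \<forall>z\<in>K. cmod (poly p z - (f z + g z)) < e" by blast
qed

lemma poly_approximable_bounded:
  assumes "compact K" "poly_approximable K f"
  shows "\<exists>B>0. \<forall>z\<in>K. cmod (f z) \<le> B"
proof -
  obtain p :: "complex poly" where p: "\<forall>z\<in>K. cmod (poly p z - f z) < 1"
    using assms(2) zero_less_one unfolding poly_approximable_def by blast
  have "bounded (poly p ` K)"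
    by (intro compact_imp_bounded compact_continuous_image continuous_intros assms)
  then obtain B where B: "B > 0" "\<forall>z\<in>K. cmod (poly p z) \<le> B"
    by (auto simp: bounded_pos)
  have "cmod (f z) \<le> B + 1" if "z \<in> K" for z
    using norm_triangle_ineq4[of "poly p z" "poly p z - f z"] p B that by fastforce
  with B show ?thesis by (intro exI[of _ "B + 1"]) auto
qed

lemma poly_approximable_mult:
  assumes K: "compact K" and f: "poly_approximable K f" and g: "poly_approximable K g"
  shows "poly_approximable K (\<lambda>z. f z * g z)"
  unfolding poly_approximable_def
proof (intro allI impI)
  fix e :: real assume e: "e > 0"
  obtain B where B: "B > 0" "\<forall>z\<in>K. cmod (g z) \<le> B"
    using poly_approximable_bounded[OF K g] by blast
  have "e / (2 * B) > 0" using e B by simp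
  then obtain p :: "complex poly" where p: "\<forall>z\<in>K. cmod (poly p z - f z) < e / (2 * B)"
    using f unfolding poly_approximable_def by blast
  obtain C where C: "C > 0" "\<forall>z\<in>K. cmod (poly p z) \<le> C"
    using poly_approximable_bounded[OF K poly_approximable_poly] by blast
  have "e / (2 * C) > 0" using e C by simp
  then obtain q :: "complex poly" where q: "\<forall>z\<in>K. cmod (poly q z - g z) < e / (2 * C)"
    using g unfolding poly_approximable_def by blast
  have "cmod (poly (p * q) z - f z * g z) < e" if z: "z \<in> K" for z
  proof -
    have "poly (p * q) z - f z * g z = poly p z * (poly q z - g z) + (poly p z - f z) * g z"
      by (simp add: algebra_simps)
    then have "cmod (poly (p * q) z - f z * g z) \<le>
        cmod (poly p z) * cmod (poly q z - g z) + cmod (poly p z - f z) * cmod (g z)"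
      by (metis norm_mult norm_triangle_ineq)
    also have "\<dots> \<le> C * cmod (poly q z - g z) + cmod (poly p z - f z) * B"
      using z B C by (intro add_mono mult_right_mono mult_left_mono) auto
    also have "\<dots> < C * (e / (2 * C)) + (e / (2 * B)) * B"
      using z B C p q by (intro add_strict_mono mult_strict_left_mono mult_strict_right_mono) auto
    also have "\<dots> = e" using B C by (simp add: field_simps)
    finally show ?thesis .
  qed
  then show "\<exists>p. \<forall>z\<in>K. cmod (poly p z - f z * g z) < e" by blast
qed

lemma poly_approximable_cmult:
  assumes "compact K" "poly_approximable K f"
  shows "poly_approximable K (\<lambda>z. c * f z)"
  using poly_approximable_mult[OF assms(1) poly_approximable_const assms(2)] .

lemma poly_approximable_diff:
  assumes "compact K" "poly_approximable K f" "poly_approximable K g"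
  shows "poly_approximable K (\<lambda>z. f z - g z)"
  using poly_approximable_add[OF assms(2) poly_approximable_cmult[OF assms(1,3), of "-1"]] by simp

lemma poly_approximable_sum:
  assumes "\<And>i. i \<in> I \<Longrightarrow> poly_approximable K (f i)"
  shows "poly_approximable K (\<lambda>z. \<Sum>i\<in>I. f i z)"
  using assms
proof (induction I rule: infinite_finite_induct)
  case (insert i I)
  then show ?case using poly_approximable_add[of K "f i" "\<lambda>z. \<Sum>i\<in>I. f i z"] by simp
qed (simp_all add: poly_approximable_const)

lemma poly_approximable_power:
  assumes "compact K" "poly_approximable K f"
  shows "poly_approximable K (\<lambda>z. f z ^ n)"
proof (induction n)
  case (Suc n)
  then show ?case using poly_approximable_mult[OF assms Suc] by simp
qed (simp add: poly_approximable_const)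

section \<open>Holomorphic functional calculus in the algebra\<close>

text \<open>The Taylor series of \<open>h\<close> at \<open>a\<close> converges uniformly on
  \<open>cball a r\<close>, which contains the values of \<open>f\<close> on \<open>K\<close>, and
  its partial sums in \<open>f\<close> stay in the algebra.\<close>

lemma poly_approximable_holomorphic_compose:
  assumes K: "compact K" and f: "poly_approximable K f"
    and h: "h holomorphic_on ball a R" and "0 \<le> r" "r < R"
    and fr: "\<And>z. z \<in> K \<Longrightarrow> cmod (f z - a) \<le> r"
  shows "poly_approximable K (\<lambda>z. h (f z))"
proof (rule poly_approximable_limit)
  fix e :: real assume "e > 0"
  define c where "c = (\<lambda>n. (deriv ^^ n) h a / fact n)"
  have sums: "(\<lambda>n. c n * (w - a) ^ n) sums h w" if "w \<in> ball a R" for w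
    unfolding c_def by (rule holomorphic_power_series[OF h that])
  \<comment> \<open>Convergence at the single point \<open>a + \<rho>\<close>, with
    \<open>\<rho>\<close> strictly between \<open>r\<close> and \<open>R\<close>, pushes the radius
    of convergence strictly above \<open>r\<close>.\<close>
  define \<rho> where "\<rho> = (r + R) / 2"
  have \<rho>: "r < \<rho>" "\<rho> < R" using \<open>r < R\<close> by (auto simp: \<rho>_def)
  have "summable (\<lambda>n. c n * (of_real \<rho>) ^ n)"
    using sums_summable[OF sums[of "a + of_real \<rho>"]] \<rho> \<open>0 \<le> r\<close> by (simp add: dist_norm)
  then have "conv_radius c \<ge> norm (of_real \<rho> :: complex)"
    by (rule conv_radius_geI)
  then have "ereal \<rho> \<le> conv_radius c" using \<rho> \<open>0 \<le> r\<close> by simp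
  then have "conv_radius c > ereal r"
    using \<rho>(1) by (metis less_ereal.simps(1) order.strict_trans2)
  from uniform_limitD[OF powser_uniform_limit[OF this, of a] \<open>e > 0\<close>]
  obtain n where n: "\<And>x. x \<in> cball a r \<Longrightarrow>
      dist (\<Sum>i<n. c i * (x - a) ^ i) (\<Sum>i. c i * (x - a) ^ i) < e"
    unfolding eventually_sequentially by blast
  show "\<exists>g. poly_approximable K g \<and> (\<forall>z\<in>K. cmod (g z - h (f z)) \<le> e)"
  proof (rule exI[of _ "\<lambda>z. \<Sum>i<n. c i * (f z - a) ^ i"], intro conjI ballI)
    show "poly_approximable K (\<lambda>z. \<Sum>i<n. c i * (f z - a) ^ i)"
      by (rule poly_approximable_sum, rule poly_approximable_cmult[OF K],
          rule poly_approximable_power[OF K],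
          rule poly_approximable_diff[OF K f poly_approximable_const])
    fix z assume z: "z \<in> K"
    have "f z \<in> cball a r" using fr[OF z] by (simp add: dist_norm norm_minus_commute)
    moreover from this have "(\<Sum>i. c i * (f z - a) ^ i) = h (f z)"
      using \<open>r < R\<close> sums_unique[OF sums[of "f z"]] by simp
    ultimately show "cmod ((\<Sum>i<n. c i * (f z - a) ^ i) - h (f z)) \<le> e"
      using n[of "f z"] unfolding dist_norm by (metis less_imp_le)
  qed
qed

lemma poly_approximable_inverse_one_minus:
  assumes "compact K" "poly_approximable K f" "r < 1" "\<And>z. z \<in> K \<Longrightarrow> cmod (f z) \<le> r"
  shows "poly_approximable K (\<lambda>z. 1 / (1 - f z))" "poly_approximable K (\<lambda>z. Ln (1 - f z))"
proof -
  \<comment> \<open>The bound \<open>r\<close> may be negative when \<open>K\<close> is empty, hence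
    the maximum with 0.\<close>
  have r: "0 \<le> max r 0" "max r 0 < 1" "\<And>z. z \<in> K \<Longrightarrow> cmod (f z - 0) \<le> max r 0"
    using assms(3,4) by (simp_all add: le_max_iff_disj)
  have "(\<lambda>w. 1 / (1 - w)) holomorphic_on ball 0 (1::real)"
    by (intro holomorphic_intros) auto
  from poly_approximable_holomorphic_compose[OF assms(1,2) this r]
  show "poly_approximable K (\<lambda>z. 1 / (1 - f z))" .
  have "1 - w \<notin> \<real>\<^sub>\<le>\<^sub>0" if "w \<in> ball 0 1" for w :: complex
    using that complex_Re_le_cmod[of w] by (auto simp: complex_nonpos_Reals_iff)
  then have "(\<lambda>w. Ln (1 - w)) holomorphic_on ball 0 (1::real)"
    by (intro holomorphic_intros) auto
  from poly_approximable_holomorphic_compose[OF assms(1,2) this r]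
  show "poly_approximable K (\<lambda>z. Ln (1 - f z))" .
qed

lemma poly_approximable_exp:
  assumes "compact K" "poly_approximable K f"
  shows "poly_approximable K (\<lambda>z. exp (f z))"
proof -
  obtain B where B: "B > 0" "\<forall>z\<in>K. cmod (f z) \<le> B"
    using poly_approximable_bounded[OF assms] by blast
  show ?thesis
    by (rule poly_approximable_holomorphic_compose[OF assms, of exp 0 "B + 1" B])
       (use B in \<open>auto intro!: holomorphic_intros\<close>)
qed

section \<open>Pushing poles through the complement\<close>

text \<open>The distance from \<open>x\<close> attains its minimum on a nonempty compact
  \<open>K\<close>, so a pointwise strict inequality gains a uniform margin, as the power series in
  \<open>poly_approximable_inverse_one_minus\<close> require.\<close>

lemma compact_dist_less_uniform:
  fixes K :: "complex set"
  assumes "compact K" "\<And>z. z \<in> K \<Longrightarrow> d < cmod (z - x)" "d \<ge> 0"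
  shows "\<exists>r<1. \<forall>z\<in>K. d / cmod (z - x) \<le> r"
proof (cases "K = {}")
  case False
  obtain y where y: "y \<in> K" "\<forall>z\<in>K. cmod (y - x) \<le> cmod (z - x)"
    using continuous_attains_inf[OF assms(1) False, of "\<lambda>z. cmod (z - x)"]
      continuous_on_norm[OF continuous_on_diff[OF continuous_on_id continuous_on_const]]
    by blast
  have d: "d < cmod (y - x)" using y assms by blast
  have "d / cmod (z - x) \<le> d / cmod (y - x)" if "z \<in> K" for z
    using y(2) d that \<open>d \<ge> 0\<close>
    by (smt (verit) frac_le)
  moreover have "d / cmod (y - x) < 1" using d \<open>d \<ge> 0\<close> by (simp add: divide_less_eq)
  ultimately show ?thesis by blast
next
  case True
  then show ?thesis using zero_less_one by blast
qed

text \<open>Near each point of \<open>E\<close> the step applies in both directions, so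
  \<open>P\<close> is locally constant on \<open>E\<close>, hence constant by connectedness. It
  serves both to move a pole to infinity and to continue a logarithm along a path.\<close>

lemma connected_induction_off_compact:
  fixes K E :: "complex set"
  assumes "connected E" "compact K" "E \<inter> K = {}" "p \<in> E" "q \<in> E" "P p"
    and step: "\<And>x y. \<lbrakk>x \<in> E; y \<in> E; \<And>z. z \<in> K \<Longrightarrow> cmod (y - x) < cmod (z - x); P x\<rbrakk> \<Longrightarrow> P y"
  shows "P q"
proof (rule connected_induction_simple[where P = P, OF \<open>connected E\<close> \<open>p \<in> E\<close> \<open>q \<in> E\<close> \<open>P p\<close>])
  fix a assume a: "a \<in> E"
  then have "a \<in> - K" using assms(3) by blast
  moreover have "open (- K)" using compact_imp_closed[OF assms(2)] by (rule open_Compl)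
  ultimately obtain d where d: "d > 0" "ball a d \<subseteq> - K" by (auto simp: open_contains_ball)
  \<comment> \<open>With radius \<open>d/3\<close>, two points of \<open>?T\<close> are less than
    \<open>2d/3\<close> apart, while both are more than \<open>2d/3\<close> away from
    \<open>K\<close>.\<close>
  let ?T = "E \<inter> ball a (d/3)"
  have TP: "P y" if xy: "x \<in> ?T" "y \<in> ?T" "P x" for x y
  proof (rule step[of x y])
    fix z assume "z \<in> K"
    then have "z \<notin> ball a d" using d by blast
    then have "dist a z \<ge> d" by simp
    moreover have "dist a x < d/3" "dist a y < d/3" using xy by simp_all
    ultimately have "dist y x < dist z x"
      using dist_triangle[of a z x] dist_triangle[of y x a]
      by (simp add: dist_commute)
    then show "cmod (y - x) < cmod (z - x)" by (simp add: dist_norm)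
  qed (use xy in simp_all)
  have T: "openin (top_of_set E) ?T" by (rule openin_open_Int[OF open_ball])
  have aT: "a \<in> ?T" using a d(1) by simp
  show "\<exists>T. openin (top_of_set E) T \<and> a \<in> T \<and> (\<forall>x\<in>T. \<forall>y\<in>T. P x \<longrightarrow> P y)"
    using T aT TP by blast
qed

text \<open>Put \<open>f = (y - x) / (z - x)\<close>, so that
  \<open>1 - f = (z - y) / (z - x)\<close>. Since \<open>f\<close> is bounded by some
  \<open>r < 1\<close> on \<open>K\<close>, the power series of \<open>1 / (1 - f)\<close> and
  \<open>Ln (1 - f)\<close> converge uniformly.\<close>

lemma poly_approximable_inverse_shift:
  assumes K: "compact K" and x: "poly_approximable K (\<lambda>z. 1 / (z - x))"
    and xy: "\<And>z. z \<in> K \<Longrightarrow> cmod (y - x) < cmod (z - x)"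
  shows "poly_approximable K (\<lambda>z. 1 / (z - y))"
    and "poly_approximable K (\<lambda>z. Ln ((z - y) / (z - x)))"
proof -
  obtain r where r: "r < 1" "\<forall>z\<in>K. cmod (y - x) / cmod (z - x) \<le> r"
    using compact_dist_less_uniform[OF K xy] by auto
  define f where "f = (\<lambda>z. (y - x) * (1 / (z - x)))"
  have f: "poly_approximable K f"
    unfolding f_def by (rule poly_approximable_cmult[OF K x])
  have fr: "cmod (f z) \<le> r" if "z \<in> K" for z
    using r that by (simp add: f_def norm_divide)
  have nz: "z - x \<noteq> 0" "z - y \<noteq> 0" if "z \<in> K" for z
    using xy[OF that] by auto
  show "poly_approximable K (\<lambda>z. 1 / (z - y))"
  proof (rule poly_approximable_cong)
    show "poly_approximable K (\<lambda>z. (1 / (z - x)) * (1 / (1 - f z)))"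
      by (intro poly_approximable_mult K x poly_approximable_inverse_one_minus(1)[OF K f r(1) fr])
    fix z assume "z \<in> K"
    with nz[of z] show "(1 / (z - x)) * (1 / (1 - f z)) = 1 / (z - y)"
      by (auto simp: f_def field_simps)
  qed
  show "poly_approximable K (\<lambda>z. Ln ((z - y) / (z - x)))"
  proof (rule poly_approximable_cong[OF poly_approximable_inverse_one_minus(2)[OF K f r(1) fr]])
    fix z assume "z \<in> K"
    with nz[of z] have "1 - f z = (z - y) / (z - x)"
      by (auto simp: f_def field_simps)
    then show "Ln (1 - f z) = Ln ((z - y) / (z - x))" by simp
  qed
qed

text \<open>For a pole far from \<open>K\<close> a geometric series in \<open>z / p\<close>
  suffices; the pole is then moved to \<open>q\<close> inside the connected complement by small
  shifts.\<close>

lemma poly_approximable_simple_pole: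
  assumes K: "compact K" and conn: "connected (- K)" and q: "q \<notin> K"
  shows "poly_approximable K (\<lambda>z. 1 / (z - q))"
proof -
  obtain B where B: "B > 0" "\<forall>z\<in>K. cmod z \<le> B"
    using compact_imp_bounded[OF K] by (auto simp: bounded_pos)
  define p where "p = complex_of_real (2 * B)"
  have p: "cmod p = 2 * B" using B by (simp add: p_def)
  have pK: "p \<in> - K" using p B by auto
  have "poly_approximable K (\<lambda>z. 1 / (z - p))"
  proof (rule poly_approximable_cong)
    have "cmod (1 / p * z) \<le> 1/2" if "z \<in> K" for z
      using B p that by (auto simp: norm_mult norm_divide field_simps)
    then show "poly_approximable K (\<lambda>z. (- 1 / p) * (1 / (1 - 1 / p * z)))"
      by (intro poly_approximable_cmult K poly_approximable_inverse_one_minus(1)[where r = "1/2"] poly_approximable_ident)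
         auto
    fix z assume "z \<in> K"
    then have "z \<noteq> p" "p \<noteq> 0" using pK B p by auto
    then show "(- 1 / p) * (1 / (1 - 1 / p * z)) = 1 / (z - p)"
      by (auto simp: divide_simps) 
  qed
  then show ?thesis
    using connected_induction_off_compact[where P = "\<lambda>q. poly_approximable K (\<lambda>z. 1 / (z - q))",
        OF conn K _ pK, of q] q poly_approximable_inverse_shift(1)[OF K] by simp
qed

subsection \<open>Regularised poles\<close>

text \<open>Both arguments lie strictly between \<open>-pi/2\<close> and \<open>pi/2\<close>, so
  their sum does not reach the branch cut.\<close>

lemma Ln_mult_right_half_plane:
  assumes "Re a > 0" "Re b > 0"
  shows "Ln (a * b) = Ln a + Ln b"
proof -
  have "a \<noteq> 0" "b \<noteq> 0" using assms by auto
  moreover from this have "\<bar>Im (Ln a)\<bar> < pi/2" "\<bar>Im (Ln b)\<bar> < pi/2"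
    using Re_Ln_pos_lt assms by blast+
  ultimately show ?thesis by (intro Ln_times_simple) auto
qed

lemma Re_divide_pos_of_near:
  fixes u v :: complex
  assumes "cmod (u - v) < cmod v"
  shows "Re (u / v) > 0"
proof -
  have "v \<noteq> 0" using assms by auto
  then have "cmod (u / v - 1) = cmod (u - v) / cmod v"
    by (simp add: norm_divide[symmetric] diff_divide_distrib)
  also have "\<dots> < 1" using assms \<open>v \<noteq> 0\<close> by (simp add: divide_less_eq)
  finally show ?thesis using abs_Re_le_cmod[of "u / v - 1"] by simp
qed

text \<open>Induction on the endpoint \<open>q\<close> along \<open>E\<close>: a short move from
  \<open>x\<close> to \<open>y\<close> adds \<open>Ln ((z - y) / (z - x))\<close>. Far from
  \<open>c\<close> the branch is identified with the principal one, which later fixes the sign of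
  the square root.\<close>

lemma log_quotient_branch:
  assumes K: "compact K" "connected (- K)"
    and E: "connected E" "E \<inter> K = {}" "E \<subseteq> cball c (2 * d)" "p \<in> E" "q \<in> E"
    and d: "d > 0"
  shows "\<exists>L. poly_approximable K L \<and>
           (\<forall>z\<in>K. exp (L z) = (z - q) / (z - p) \<and>
              (7 * d \<le> cmod (z - c) \<longrightarrow> L z = Ln ((z - q) / (z - p))))"
proof (rule connected_induction_off_compact[where K = K and E = E and p = p and q = q and
        P = "\<lambda>q. \<exists>L. poly_approximable K L \<and>
           (\<forall>z\<in>K. exp (L z) = (z - q) / (z - p) \<and>
              (7 * d \<le> cmod (z - c) \<longrightarrow> L z = Ln ((z - q) / (z - p))))"])
  have "z \<noteq> p" if "z \<in> K" for z using that E by blast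
  then show "\<exists>L. poly_approximable K L \<and>
           (\<forall>z\<in>K. exp (L z) = (z - p) / (z - p) \<and>
              (7 * d \<le> cmod (z - c) \<longrightarrow> L z = Ln ((z - p) / (z - p))))"
    by (intro exI[of _ "\<lambda>z. 0"]) (simp add: poly_approximable_const)
next
  fix x y assume xy: "x \<in> E" "y \<in> E" and close: "\<And>z. z \<in> K \<Longrightarrow> cmod (y - x) < cmod (z - x)"
    and "\<exists>L. poly_approximable K L \<and>
           (\<forall>z\<in>K. exp (L z) = (z - x) / (z - p) \<and>
              (7 * d \<le> cmod (z - c) \<longrightarrow> L z = Ln ((z - x) / (z - p))))"
  then obtain L where L: "poly_approximable K L"
      "\<And>z. z \<in> K \<Longrightarrow> exp (L z) = (z - x) / (z - p)"
      "\<And>z. z \<in> K \<Longrightarrow> 7 * d \<le> cmod (z - c) \<Longrightarrow> L z = Ln ((z - x) / (z - p))"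
    by blast
  define L' where "L' = (\<lambda>z. L z + Ln ((z - y) / (z - x)))"
  have nz: "z \<noteq> x" "z \<noteq> y" "z \<noteq> p" if "z \<in> K" for z using that E xy by blast+
  have "x \<notin> K" using xy E by blast
  have "poly_approximable K L'"
    unfolding L'_def
    by (rule poly_approximable_add[OF L(1) poly_approximable_inverse_shift(2)[OF K(1)
          poly_approximable_simple_pole[OF K \<open>x \<notin> K\<close>] close]])
  moreover have "exp (L' z) = (z - y) / (z - p)" if z: "z \<in> K" for z
    using nz[OF z] L(2)[OF z] by (simp add: L'_def exp_add)
  moreover have "L' z = Ln ((z - y) / (z - p))" if z: "z \<in> K" and far: "7 * d \<le> cmod (z - c)" for z
  proof -
    \<comment> \<open>Points of \<open>E\<close> are at most \<open>4d\<close> apart, while a point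
      at distance \<open>7d\<close> or more from \<open>c\<close> is at least \<open>5d\<close> from
      each of them. All quotients below therefore lie in the right half-plane, where principal
      logarithms add.\<close>
    have b: "cmod (w - c) \<le> 2 * d" if "w \<in> E" for w
      using that E by (auto simp: dist_norm norm_minus_commute subset_iff)
    have near: "cmod (u - w) < cmod (z - w)" if "u \<in> E" "w \<in> E" for u w
      using b[OF that(1)] b[OF that(2)] far d norm_triangle_ineq4[of "u - c" "w - c"]
        norm_triangle_ineq[of "z - w" "w - c"] by simp
    have "Re ((z - x) / (z - p)) > 0"
      by (rule Re_divide_pos_of_near) (use near[OF xy(1) E(4)] in \<open>simp add: norm_minus_commute\<close>)
    moreover have "Re ((z - y) / (z - x)) > 0"
      by (rule Re_divide_pos_of_near) (use near[OF xy(2,1)] in \<open>simp add: norm_minus_commute\<close>)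
    ultimately have "Ln ((z - x) / (z - p) * ((z - y) / (z - x))) = L' z"
      using L(3)[OF z far] Ln_mult_right_half_plane unfolding L'_def by metis
    then show ?thesis using nz[OF z] by simp
  qed
  ultimately show "\<exists>L. poly_approximable K L \<and>
           (\<forall>z\<in>K. exp (L z) = (z - y) / (z - p) \<and>
              (7 * d \<le> cmod (z - c) \<longrightarrow> L z = Ln ((z - y) / (z - p))))"
    by blast
qed (use assms in auto)

section \<open>Estimates for the function replacing a simple pole\<close>

text \<open>Here \<open>(w - a) t\<close> is a square root of \<open>(w - a) (w - b)\<close>.
  Multiplying by the conjugate expression \<open>D\<close> turns the quotient into
  \<open>4 / D\<close>, and \<open>D\<close> differs from \<open>4 w\<close> by \<open>O(d)\<close>.
  The condition on \<open>Re t\<close> selects the root close to \<open>w\<close>.\<close>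

lemma joukowski_far_estimate:
  fixes w a b t :: complex and d :: real
  assumes a: "cmod a \<le> d" and b: "cmod b \<le> 2 * d" and w: "7 * d \<le> cmod w" and d: "d > 0"
    and ab: "a \<noteq> b" and t: "t\<^sup>2 = (w - b) / (w - a)" "Re t \<ge> 0"
  shows "cmod (4 * (2 * w - a - b - 2 * ((w - a) * t)) / (a - b)\<^sup>2 - 1 / w) \<le> 6 * d / (cmod w)\<^sup>2"
proof -
  have wa: "w - a \<noteq> 0" using a w d by auto
  have w0: "w \<noteq> 0" using w d by auto
  define D where "D = 2 * w - a - b + 2 * ((w - a) * t)"
  define e where "e = D - 4 * w"
  have st: "(w - a) * t\<^sup>2 = w - b" using t wa by simp
  \<comment> \<open>Since \<open>(w - a) (t - 1) (t + 1) = a - b\<close>, a lower bound for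
    \<open>t + 1\<close> bounds \<open>(w - a) (t - 1)\<close> by \<open>3d\<close>.\<close>
  have "1 \<le> cmod (t + 1)"
    using complex_Re_le_cmod[of "t + 1"] t(2) by simp
  then have "cmod ((w - a) * (t - 1)) * 1 \<le> cmod ((w - a) * (t - 1)) * cmod (t + 1)"
    by (rule mult_left_mono) simp
  also have "\<dots> = cmod ((w - a) * t\<^sup>2 - (w - a))"
    unfolding norm_mult[symmetric] by (simp add: algebra_simps power2_eq_square)
  also have "\<dots> = cmod (a - b)" unfolding st by simp
  finally have t1: "cmod ((w - a) * (t - 1)) \<le> 3 * d"
    using norm_triangle_ineq4[of a b] a b by linarith
  have "e = 2 * ((w - a) * (t - 1)) - (3 * a + b)"
    by (simp add: e_def D_def algebra_simps)
  then have "cmod e \<le> cmod (2 * ((w - a) * (t - 1))) + cmod (3 * a + b)"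
    by (metis norm_triangle_ineq4)
  also have "\<dots> \<le> 2 * cmod ((w - a) * (t - 1)) + (cmod (3 * a) + cmod b)"
    using norm_triangle_ineq[of "3 * a" b] by (simp only: norm_mult norm_numeral)
  also have "\<dots> \<le> 11 * d" using t1 a b by (simp add: norm_mult)
  finally have e: "cmod e \<le> 11 * d" .
  have "cmod (4 * w) \<le> cmod D + cmod e"
    using norm_triangle_ineq4[of D e] by (simp add: e_def)
  then have D2: "cmod D \<ge> 2 * cmod w" using e w d by (simp add: norm_mult)
  then have D0: "D \<noteq> 0" using w0 by auto
  \<comment> \<open>Difference of squares:
    \<open>(2 w - a - b)^2 - 4 (w - a) (w - b) = (a - b)^2\<close>.\<close>
  have "(2 * w - a - b - 2 * ((w - a) * t)) * D = (2 * w - a - b)\<^sup>2 - 4 * (w - a) * ((w - a) * t\<^sup>2)"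
    by (simp add: D_def algebra_simps power2_eq_square)
  also have "\<dots> = (a - b)\<^sup>2"
    unfolding st by (simp add: algebra_simps power2_eq_square)
  finally have "(2 * w - a - b - 2 * ((w - a) * t)) / (a - b)\<^sup>2 = 1 / D"
    using D0 ab by (simp add: frac_eq_eq)
  then have "4 * (2 * w - a - b - 2 * ((w - a) * t)) / (a - b)\<^sup>2 = 4 / D"
    by (metis times_divide_eq_right mult.right_neutral)
  also have "4 / D - 1 / w = - e / (w * D)"
    using D0 w0 by (simp add: e_def field_simps)
  finally have "cmod (4 * (2 * w - a - b - 2 * ((w - a) * t)) / (a - b)\<^sup>2 - 1 / w)
      = cmod e / (cmod w * cmod D)"
    by (simp add: norm_divide norm_mult)
  also have "\<dots> \<le> 12 * d / (cmod w * (2 * cmod w))"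
    using e d w0 D2 by (intro frac_le mult_left_mono) auto
  also have "\<dots> = 6 * d / (cmod w)\<^sup>2" using w0 by (simp add: power2_eq_square)
  finally show ?thesis .
qed

text \<open>The numerator is \<open>O(d)\<close> for either sign of the root, and the separation of
  \<open>a\<close> and \<open>b\<close> keeps the denominator of order \<open>d^2\<close>. There is
  no singularity at \<open>w = 0\<close>.\<close>

lemma joukowski_near_estimate:
  fixes w a b s :: complex and d :: real
  assumes a: "cmod a \<le> d" and b: "cmod b = 2 * d" and w: "cmod w \<le> 7 * d" and d: "d > 0"
    and s: "s\<^sup>2 = (w - a) * (w - b)"
  shows "cmod (4 * (2 * w - a - b - 2 * s) / (a - b)\<^sup>2) \<le> 140 / d"
proof -
  have "cmod s ^ 2 = cmod (w - a) * cmod (w - b)"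
    using s by (metis norm_mult norm_power)
  also have "\<dots> \<le> (8 * d) * (9 * d)"
    using norm_triangle_ineq4[of w a] norm_triangle_ineq4[of w b] a b w d
    by (intro mult_mono) auto
  also have "\<dots> \<le> (9 * d)\<^sup>2" using d by (simp add: power2_eq_square)
  finally have s9: "cmod s \<le> 9 * d" using d by (auto intro: power2_le_imp_le)
  have "cmod (2 * w - a - b - 2 * s) \<le> cmod (2 * w - a - b) + cmod (2 * s)"
    by (rule norm_triangle_ineq4)
  also have "\<dots> \<le> (cmod (2 * w) + cmod a + cmod b) + cmod (2 * s)"
    using norm_triangle_ineq4[of "2 * w" a] norm_triangle_ineq4[of "2 * w - a" b] by simp
  also have "\<dots> \<le> 35 * d" using a b w s9 by (simp add: norm_mult)
  finally have J: "cmod (2 * w - a - b - 2 * s) \<le> 35 * d" .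
  have ab: "d \<le> cmod (a - b)" using norm_triangle_ineq3[of a b] a b by simp
  have "cmod (4 * (2 * w - a - b - 2 * s) / (a - b)\<^sup>2)
      = 4 * cmod (2 * w - a - b - 2 * s) / (cmod (a - b))\<^sup>2"
    by (simp only: norm_divide norm_mult norm_power norm_numeral)
  also have "\<dots> \<le> 4 * (35 * d) / d\<^sup>2"
    using J ab d by (intro frac_le mult_left_mono power_mono) auto
  also have "\<dots> = 140 / d" using d by (simp add: power2_eq_square)
  finally show ?thesis .
qed

text \<open>Empty interior supplies a point \<open>p\<close> off \<open>K\<close> close to
  \<open>c\<close>, and connectedness of the complement a path from \<open>p\<close> to a distant
  point; it is cut where it first leaves the disc of radius \<open>2d\<close>. The gap between the
  radii \<open>d\<close> and \<open>2d\<close> keeps \<open>p\<close> and \<open>q\<close>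
  apart.\<close>

lemma exists_short_path_off_compact:
  fixes K :: "complex set"
  assumes K: "compact K" "connected (- K)" "interior K = {}" and d: "d > 0"
  shows "\<exists>E p q. connected E \<and> E \<inter> K = {} \<and> E \<subseteq> cball c (2 * d) \<and> p \<in> E \<and> q \<in> E \<and>
           cmod (p - c) \<le> d \<and> cmod (q - c) = 2 * d"
proof -
  have "\<not> ball c d \<subseteq> K"
  proof
    assume "ball c d \<subseteq> K"
    then have "ball c d \<subseteq> interior K" by (simp add: interior_maximal)
    then show False using K(3) d by simp
  qed
  then obtain p where p: "p \<in> - K" "dist c p < d" by (auto simp: subset_iff)
  obtain B where B: "\<forall>z\<in>K. cmod z \<le> B"
    using compact_imp_bounded[OF K(1)] by (auto simp: bounded_iff)
  \<comment> \<open>A point beyond both \<open>K\<close> and the disc; the absolute value covers a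
    negative \<open>B\<close>, possible when \<open>K\<close> is empty.\<close>
  define x where "x = complex_of_real (\<bar>B\<bar> + cmod c + 3 * d)"
  have x: "cmod x = \<bar>B\<bar> + cmod c + 3 * d"
    unfolding x_def norm_of_real using d norm_ge_zero[of c] by linarith
  have "x \<in> - K"
  proof
    assume "x \<in> K"
    with B have "cmod x \<le> B" by blast
    with x d norm_ge_zero[of c] show False by linarith
  qed
  have xc: "x \<notin> cball c (2 * d)"
    using x d norm_triangle_ineq2[of x c] by (simp add: dist_norm norm_minus_commute)
  have "open (- K)" using compact_imp_closed[OF K(1)] by (rule open_Compl)
  then have "path_connected (- K)" using K(2) by (simp add: connected_open_path_connected)
  then obtain g where g: "path g" "path_image g \<subseteq> - K" "pathstart g = p" "pathfinish g = x"
    using p(1) \<open>x \<in> - K\<close> unfolding path_connected_def by blast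
  have "pathstart g \<in> cball c (2 * d)" "pathfinish g \<notin> cball c (2 * d)"
    using g p xc d by auto
  from exists_path_subpath_to_frontier_closed[OF closed_cball g(1) this]
  obtain h where h: "path h" "pathstart h = pathstart g"
      "path_image h \<subseteq> path_image g \<inter> cball c (2 * d)" "pathfinish h \<in> frontier (cball c (2 * d))" .
  show ?thesis
  proof (intro exI conjI)
    show "connected (path_image h)" using h by (simp add: connected_path_image)
    show "path_image h \<inter> K = {}" using h g by blast
    show "path_image h \<subseteq> cball c (2 * d)" using h by blast
    show "p \<in> path_image h" using h g by (metis pathstart_in_path_image)
    show "pathfinish h \<in> path_image h" by (rule pathfinish_in_path_image)
    show "cmod (p - c) \<le> d" using p by (simp add: dist_norm norm_minus_commute)
    show "cmod (pathfinish h - c) = 2 * d"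
      using h(4) d by (simp add: frontier_cball dist_norm norm_minus_commute)
  qed
qed

text \<open>This \<open>k\<close> replaces \<open>1 / (z - c)\<close> even when \<open>c\<close>
  lies in \<open>K\<close>. Its square root is \<open>(z - p) exp (L / 2)\<close>, with
  \<open>L\<close> the logarithm of \<open>(z - q) / (z - p)\<close> continued along the
  path.\<close>

lemma exists_regularised_pole:
  assumes K: "compact K" "connected (- K)" "interior K = {}" and d: "d > 0"
  shows "\<exists>k. poly_approximable K k \<and>
           (\<forall>z\<in>K. (7 * d \<le> cmod (z - c) \<longrightarrow> cmod (k z - 1 / (z - c)) \<le> 6 * d / (cmod (z - c))\<^sup>2) \<and>
                  (cmod (z - c) \<le> 7 * d \<longrightarrow> cmod (k z) \<le> 140 / d))"
proof -
  obtain E p q where E: "connected E" "E \<inter> K = {}" "E \<subseteq> cball c (2 * d)" "p \<in> E" "q \<in> E"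
    and pq: "cmod (p - c) \<le> d" "cmod (q - c) = 2 * d"
    using exists_short_path_off_compact[OF K d] by blast
  obtain L where L: "poly_approximable K L"
      "\<And>z. z \<in> K \<Longrightarrow> exp (L z) = (z - q) / (z - p)"
      "\<And>z. z \<in> K \<Longrightarrow> 7 * d \<le> cmod (z - c) \<Longrightarrow> L z = Ln ((z - q) / (z - p))"
    using log_quotient_branch[OF K(1,2) E d] by blast
  define t where "t = (\<lambda>z. exp (1/2 * L z))"
  define s where "s = (\<lambda>z. (z - p) * t z)"
  define k where "k = (\<lambda>z. 4 / (p - q)\<^sup>2 * (2 * z - (p + q) - 2 * s z))"
  have ne: "p \<noteq> q" using pq d by auto
  have nz: "z \<noteq> p" "z \<noteq> q" if "z \<in> K" for z using that E by blast+
  have t2: "(t z)\<^sup>2 = (z - q) / (z - p)" if "z \<in> K" for z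
    using L(2)[OF that] by (simp add: t_def exp_double[symmetric])
  have "poly_approximable K k"
    unfolding k_def s_def t_def
    by (rule poly_approximable_cmult[OF K(1)], rule poly_approximable_diff[OF K(1)],
        rule poly_approximable_diff[OF K(1)], rule poly_approximable_cmult[OF K(1)],
        rule poly_approximable_ident, rule poly_approximable_const,
        rule poly_approximable_cmult[OF K(1)], rule poly_approximable_mult[OF K(1)],
        rule poly_approximable_diff[OF K(1)], rule poly_approximable_ident,
        rule poly_approximable_const, rule poly_approximable_exp[OF K(1)],
        rule poly_approximable_cmult[OF K(1) L(1)])
  have k: "k z = 4 * (2 * (z - c) - (p - c) - (q - c) - 2 * s z) / ((p - c) - (q - c))\<^sup>2" for z
    by (simp add: k_def)
  have "cmod (k z - 1 / (z - c)) \<le> 6 * d / (cmod (z - c))\<^sup>2"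
    if z: "z \<in> K" and far: "7 * d \<le> cmod (z - c)" for z
  proof -
    \<comment> \<open>Far away \<open>L\<close> is the principal logarithm, so halving it brings the
      argument into \<open>[-pi/2, pi/2]\<close>.\<close>
    have "Re (t z) \<ge> 0"
    proof -
      have "\<bar>Im (1/2 * L z)\<bar> \<le> pi/2"
        using L(3)[OF z far] mpi_less_Im_Ln[of "(z - q) / (z - p)"] Im_Ln_le_pi[of "(z - q) / (z - p)"] nz[OF z]
        by simp
      then have "cos (Im (1/2 * L z)) \<ge> 0" by (intro cos_ge_zero) auto
      then show ?thesis unfolding t_def Re_exp by simp
    qed
    moreover have "(t z)\<^sup>2 = ((z - c) - (q - c)) / ((z - c) - (p - c))" using t2[OF z] by simp
    ultimately show ?thesis
      using joukowski_far_estimate[of "p - c" d "q - c" "z - c" "t z"] pq far d ne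
      unfolding k s_def by simp
  qed
  moreover have "cmod (k z) \<le> 140 / d" if z: "z \<in> K" and near: "cmod (z - c) \<le> 7 * d" for z
  proof -
    have "(s z)\<^sup>2 = (z - p)\<^sup>2 * ((z - q) / (z - p))"
      using t2[OF z] by (simp add: s_def power_mult_distrib)
    also have "\<dots> = ((z - c) - (p - c)) * ((z - c) - (q - c))"
      using nz[OF z] by (simp add: power2_eq_square)
    finally show ?thesis
      unfolding k by (intro joukowski_near_estimate pq near d)
  qed
  ultimately show ?thesis using \<open>poly_approximable K k\<close> by blast
qed

subsection \<open>Sums and logarithms along a row\<close>

text \<open>Rounding \<open>t\<close> down to an integer \<open>f\<close> costs a factor 2 per term;
  the integers on each side of \<open>f\<close> then contribute at most one harmonic sum.\<close>

lemma sum_inverse_dist_int_le_harm: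
  assumes t: "\<bar>t\<bar> \<le> real N"
  shows "(\<Sum>j\<in>{- int N..<int N}. 1 / (1 + \<bar>t - real_of_int j\<bar>)) \<le> 4 * harm (2 * N + 1)"
proof -
  define f where "f = \<lfloor>t\<rfloor>"
  have f: "real_of_int f \<le> t" "t < real_of_int f + 1" by (auto simp: f_def)
  have f': "- int N \<le> f" "f \<le> int N" using t f by linarith+
  define h where "h = (\<lambda>j. 2 / (1 + \<bar>real_of_int f - real_of_int j\<bar>))"
  have h0: "h j \<ge> 0" for j by (simp add: h_def)
  \<comment> \<open>Both \<open>A\<close> and \<open>B\<close> contain \<open>f\<close>; counting it
    twice is harmless for an upper bound.\<close>
  define A where "A = (\<lambda>i. f + int i) ` {..<2 * N + 1}"
  define B where "B = (\<lambda>i. f - int i) ` {..<2 * N + 1}"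
  have "(\<Sum>j\<in>{- int N..<int N}. 1 / (1 + \<bar>t - real_of_int j\<bar>)) \<le> (\<Sum>j\<in>{- int N..<int N}. h j)"
  proof (rule sum_mono)
    fix j :: int
    have "1 + \<bar>real_of_int f - real_of_int j\<bar> \<le> 2 * (1 + \<bar>t - real_of_int j\<bar>)"
      using f by (smt (verit))
    then show "1 / (1 + \<bar>t - real_of_int j\<bar>) \<le> h j" by (simp add: h_def field_simps)
  qed
  also have "\<dots> \<le> (\<Sum>j\<in>A \<union> B. h j)"
  proof (rule sum_mono2)
    show "{- int N..<int N} \<subseteq> A \<union> B"
    proof
      fix j assume j: "j \<in> {- int N..<int N}"
      show "j \<in> A \<union> B"
      proof (cases "j \<ge> f")
        case True
        with j f' have "j = f + int (nat (j - f))" "nat (j - f) < 2 * N + 1" by auto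
        then show ?thesis unfolding A_def by blast
      next
        case False
        with j f' have "j = f - int (nat (f - j))" "nat (f - j) < 2 * N + 1" by auto
        then show ?thesis unfolding B_def by blast
      qed
    qed
  qed (auto simp: A_def B_def h0)
  also have "\<dots> \<le> sum h A + sum h B"
    using sum.union_inter[of A B h] sum_nonneg[of "A \<inter> B" h] h0 by (simp add: A_def B_def)
  also have "sum h A = 2 * harm (2 * N + 1)"
    unfolding A_def harm_altdef
    by (subst sum.reindex) (auto simp: inj_on_def h_def sum_distrib_left field_simps intro!: sum.cong)
  also have "sum h B = 2 * harm (2 * N + 1)"
    unfolding B_def harm_altdef
    by (subst sum.reindex) (auto simp: inj_on_def h_def sum_distrib_left field_simps intro!: sum.cong)
  finally show ?thesis by simp
qed

text \<open>Discrete form of the fact that \<open>sgn (t - x)\<close> integrates to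
  \<open>2 t\<close> over \<open>[-N, N]\<close>; this is how \<open>Im z\<close> emerges from the
  jumps of the row logarithms.\<close>

lemma sum_sgn_diff_int:
  assumes t: "\<bar>t\<bar> < real N"
  shows "\<bar>(\<Sum>k\<in>{- int N..<int N}. sgn (t - real_of_int k)) - 2 * t\<bar> \<le> 2"
proof -
  define f where "f = \<lfloor>t\<rfloor>"
  have f: "real_of_int f \<le> t" "t < real_of_int f + 1" by (auto simp: f_def)
  have f': "- int N \<le> f" "f < int N" using t f by linarith+
  have "{- int N..<int N} = {- int N..<f} \<union> insert f {f + 1..<int N}" using f' by auto
  then have "(\<Sum>k\<in>{- int N..<int N}. sgn (t - real_of_int k)) =
      (\<Sum>k\<in>{- int N..<f}. sgn (t - real_of_int k)) + (sgn (t - real_of_int f) +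
       (\<Sum>k\<in>{f + 1..<int N}. sgn (t - real_of_int k)))"
    by (simp add: sum.union_disjoint)
  also have "(\<Sum>k\<in>{- int N..<f}. sgn (t - real_of_int k)) = (\<Sum>k\<in>{- int N..<f}. 1)"
    by (rule sum.cong) (use f in \<open>auto simp: sgn_if\<close>)
  also have "(\<Sum>k\<in>{f + 1..<int N}. sgn (t - real_of_int k)) = (\<Sum>k\<in>{f + 1..<int N}. - 1)"
  proof (rule sum.cong)
    fix k assume "k \<in> {f + 1..<int N}"
    then have "real_of_int k \<ge> real_of_int (f + 1)" by (simp only: of_int_le_iff) simp
    then show "sgn (t - real_of_int k) = - 1" using f by (simp add: sgn_if)
  qed simp
  finally have "(\<Sum>k\<in>{- int N..<int N}. sgn (t - real_of_int k)) =
      real_of_int (f + int N) + (sgn (t - real_of_int f) - real_of_int (int N - (f + 1)))"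
    using f' by simp
  moreover have "sgn (t - real_of_int f) = 0 \<or> sgn (t - real_of_int f) = 1"
    using f by (auto simp: sgn_if)
  ultimately show ?thesis using f by (auto simp: abs_le_iff)
qed

lemma sum_int_telescope:
  fixes F :: "int \<Rightarrow> 'a::ab_group_add"
  assumes "a \<le> b"
  shows "(\<Sum>j\<in>{a..<b}. F j - F (j + 1)) = F a - F b"
  using assms
proof (induction b rule: int_ge_induct)
  case (step b)
  then have "{a..<b + 1} = insert b {a..<b}" by auto
  then show ?case using step by simp
qed simp

text \<open>The difference is the integral of \<open>1 / x\<close> along the horizontal segment from
  \<open>w - d\<close> to \<open>w\<close>, which avoids the branch cut as \<open>Im w\<close> is
  nonzero. The first bound is a Taylor remainder, the second the mean value inequality.\<close>

lemma Ln_translate_estimates: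
  fixes w :: complex and d :: real
  assumes w: "Im w \<noteq> 0" and d: "d > 0"
  shows "7 * d \<le> cmod w \<Longrightarrow> cmod (Ln w - Ln (w - d) - d / w) \<le> 2 * d\<^sup>2 / (cmod w)\<^sup>2"
    and "d \<le> \<bar>Im w\<bar> \<Longrightarrow> cmod (Ln w - Ln (w - d)) \<le> 1"
proof -
  define S where "S = closed_segment (w - d) w"
  have S: "\<exists>u. 0 \<le> u \<and> u \<le> d \<and> x = w - of_real u" if x: "x \<in> S" for x
  proof -
    obtain u where u: "0 \<le> u" "u \<le> 1" "x = (1 - u) *\<^sub>R (w - d) + u *\<^sub>R w"
      using x by (auto simp: S_def closed_segment_def)
    then have "x = w - of_real ((1 - u) * d)" by (simp add: scaleR_conv_of_real algebra_simps)
    then show ?thesis using u d by (intro exI[of _ "(1 - u) * d"]) (auto simp: mult_le_cancel_right1)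
  qed
  have Im: "Im x = Im w" if "x \<in> S" for x using S[OF that] by auto
  have nR: "x \<notin> \<real>\<^sub>\<le>\<^sub>0" "x \<noteq> 0" if "x \<in> S" for x
    using Im[OF that] w by (auto simp: complex_nonpos_Reals_iff)
  have DL: "(Ln has_field_derivative inverse x) (at x within S)" if "x \<in> S" for x
    using has_field_derivative_Ln[OF nR(1)[OF that]] by (rule has_field_derivative_at_within)
  have wS: "w - d \<in> S" "w \<in> S" "convex S" by (auto simp: S_def)
  show "cmod (Ln w - Ln (w - d)) \<le> 1" if "d \<le> \<bar>Im w\<bar>"
  proof -
    have "cmod (inverse x) \<le> 1 / d" if "x \<in> S" for x
    proof -
      have "d \<le> cmod x" using abs_Im_le_cmod[of x] Im[OF that] \<open>d \<le> \<bar>Im w\<bar>\<close> by simp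
      from le_imp_inverse_le[OF this d] show ?thesis
        unfolding norm_inverse inverse_eq_divide[of d] .
    qed
    from field_differentiable_bound[OF wS(3) DL this wS(2,1)]
    show ?thesis using d by simp
  qed
  show "cmod (Ln w - Ln (w - d) - d / w) \<le> 2 * d\<^sup>2 / (cmod w)\<^sup>2" if far: "7 * d \<le> cmod w"
  proof -
    \<comment> \<open>\<open>Ln\<close> and its first two derivatives, in the form that
      \<open>complex_Taylor\<close> expects.\<close>
    define g where "g = (\<lambda>i::nat. if i = 0 then Ln else if i = 1 then inverse else (\<lambda>x. - (inverse x)\<^sup>2))"
    have w0: "cmod w > 0" using w by auto
    have "cmod (g 0 (w - d) - (\<Sum>i\<le>1. g i w * ((w - d) - w) ^ i / fact i))
        \<le> (2 / (cmod w)\<^sup>2) * cmod ((w - d) - w) ^ Suc 1 / fact 1"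
    proof (rule complex_Taylor[OF wS(3) _ _ wS(2,1)])
      fix i :: nat and x assume x: "x \<in> S" and i: "i \<le> 1"
      show "(g i has_field_derivative g (Suc i) x) (at x within S)"
      proof (cases "i = 0")
        case True
        then show ?thesis using DL[OF x] by (simp add: g_def)
      next
        case False
        then have "i = 1" using i by simp
        then show ?thesis using nR[OF x]
          by (auto simp: g_def power2_eq_square intro!: derivative_eq_intros)
      qed
    next
      fix x assume x: "x \<in> S"
      obtain u where u: "0 \<le> u" "u \<le> d" "x = w - of_real u" using S[OF x] by blast
      have "cmod w - d \<le> cmod x"
        using norm_triangle_ineq2[of w "of_real u"] u by simp
      then have "6/7 * cmod w \<le> cmod x" using far by simp
      then have "(6/7 * cmod w)\<^sup>2 \<le> (cmod x)\<^sup>2" using w0 by (intro power_mono) auto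
      then have "36/49 * (cmod w)\<^sup>2 \<le> (cmod x)\<^sup>2"
        unfolding power_mult_distrib by (simp add: power_divide)
      then have "(cmod w)\<^sup>2 \<le> 2 * (cmod x)\<^sup>2"
        using zero_le_power2[of "cmod x"] by linarith
      then have "1 / (cmod x)\<^sup>2 \<le> 2 / (cmod w)\<^sup>2"
        using w0 nR(2)[OF x] by (simp add: field_simps)
      moreover have "cmod (g (Suc 1) x) = 1 / (cmod x)\<^sup>2"
        by (simp add: g_def norm_power norm_divide power_divide inverse_eq_divide)
      ultimately show "cmod (g (Suc 1) x) \<le> 2 / (cmod w)\<^sup>2" by simp
    qed
    moreover have "g 0 (w - d) - (\<Sum>i\<le>1. g i w * ((w - d) - w) ^ i / fact i)
        = - (Ln w - Ln (w - d) - d / w)"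
      by (simp add: g_def field_simps)
    ultimately show ?thesis by (simp only: norm_minus_cancel) (simp add: power2_eq_square)
  qed
qed

text \<open>Negation turns \<open>v - M\<close> into the right half-plane, and the half-plane
  containing \<open>v\<close> decides the sign of the jump by \<open>\<i> pi\<close>.\<close>

lemma Ln_minus_real_shift:
  assumes "Re v < M" "Im v \<noteq> 0"
  shows "Ln (v - of_real M) = Ln (of_real M - v) + \<i> * pi * of_real (sgn (Im v))"
proof -
  have "of_real M - v \<noteq> 0" using assms by (auto simp: complex_eq_iff)
  from Ln_minus[OF this] show ?thesis using assms by (simp add: sgn_if)
qed

subsection \<open>Rows of regularised poles\<close>

lemma Ln_diff_right_half_plane:
  assumes "m > 0" "Re u \<ge> m" "Re v \<ge> m"
  shows "cmod (Ln u - Ln v) \<le> cmod (u - v) / m"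
proof -
  let ?S = "{x. Re x \<ge> m}"
  have "(Ln has_field_derivative inverse x) (at x within ?S)" if "x \<in> ?S" for x
  proof -
    have "x \<notin> \<real>\<^sub>\<le>\<^sub>0" using that assms(1) by (simp add: complex_nonpos_Reals_iff)
    then show ?thesis by (rule has_field_derivative_at_within[OF has_field_derivative_Ln])
  qed
  moreover have "cmod (inverse x) \<le> 1 / m" if "x \<in> ?S" for x
  proof -
    have "m \<le> cmod x" using complex_Re_le_cmod[of x] that by simp
    from le_imp_inverse_le[OF this assms(1)] show ?thesis
      unfolding norm_inverse inverse_eq_divide[of m] .
  qed
  ultimately show ?thesis
    using field_differentiable_bound[OF convex_halfspace_Re_ge, of m Ln inverse "1 / m" u v] assms
    by simp
qed

text \<open>Both regimes give \<open>O(d^2 / |w|^2)\<close>. The weaker product form of the bound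
  separates the coordinates, so that summing over the grid gives a product of two harmonic
  sums.\<close>

lemma regularised_row_estimate_far:
  fixes \<kappa> w :: complex and d :: real
  assumes d: "d > 0"
    and far: "7 * d \<le> cmod w \<Longrightarrow> cmod (\<kappa> - 1 / w) \<le> 6 * d / (cmod w)\<^sup>2"
    and near: "cmod w \<le> 7 * d \<Longrightarrow> cmod \<kappa> \<le> 140 / d"
    and w: "d \<le> \<bar>Im w\<bar>"
  shows "cmod (d * \<kappa> - (Ln w - Ln (w - d))) \<le> 21000 / ((1 + \<bar>Re w\<bar> / d) * (1 + \<bar>Im w\<bar> / d))"
proof -
  have "Im w \<noteq> 0" using w d by auto
  note Ln = Ln_translate_estimates[OF this d]
  have w0: "cmod w > 0" using \<open>Im w \<noteq> 0\<close> by auto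
  have "cmod (d * \<kappa> - (Ln w - Ln (w - d))) \<le> 7000 * (d\<^sup>2 / (cmod w)\<^sup>2)"
  proof (cases "7 * d \<le> cmod w")
    case True
    have "d * \<kappa> - (Ln w - Ln (w - d)) = d * (\<kappa> - 1 / w) - (Ln w - Ln (w - d) - d / w)"
      by (simp add: algebra_simps)
    then have "cmod (d * \<kappa> - (Ln w - Ln (w - d))) \<le>
        cmod (d * (\<kappa> - 1 / w)) + cmod (Ln w - Ln (w - d) - d / w)"
      by (metis norm_triangle_ineq4)
    also have "\<dots> \<le> d * (6 * d / (cmod w)\<^sup>2) + 2 * d\<^sup>2 / (cmod w)\<^sup>2"
      using Ln(1)[OF True] far[OF True] d unfolding norm_mult norm_of_real
      by (intro add_mono mult_mono) auto
    also have "\<dots> = 8 * (d\<^sup>2 / (cmod w)\<^sup>2)" by (simp add: power2_eq_square)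
    also have "\<dots> \<le> 7000 * (d\<^sup>2 / (cmod w)\<^sup>2)" by (intro mult_right_mono) auto
    finally show ?thesis .
  next
    case False
    have "cmod (d * \<kappa> - (Ln w - Ln (w - d))) \<le> cmod (d * \<kappa>) + cmod (Ln w - Ln (w - d))"
      by (rule norm_triangle_ineq4)
    also have "\<dots> \<le> d * (140 / d) + 1"
      using Ln(2)[OF w] near False d unfolding norm_mult norm_of_real
      by (intro add_mono mult_mono) auto
    also have "\<dots> = 141" using d by simp
    also have "\<dots> \<le> 7000 * (d\<^sup>2 / (cmod w)\<^sup>2)"
    proof -
      \<comment> \<open>The constant 7000 comes from \<open>141 * 49 = 6909\<close>.\<close>
      have "(cmod w)\<^sup>2 \<le> (7 * d)\<^sup>2" using False by (intro power_mono) auto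
      then have "(cmod w)\<^sup>2 \<le> 49 * d\<^sup>2" unfolding power_mult_distrib by simp
      then have "141 * (cmod w)\<^sup>2 \<le> 7000 * d\<^sup>2" using zero_le_power2[of d] by linarith
      then show ?thesis using w0 by (simp add: field_simps)
    qed
    finally show ?thesis .
  qed
  also have "\<dots> \<le> 7000 * (3 / ((1 + \<bar>Re w\<bar> / d) * (1 + \<bar>Im w\<bar> / d)))"
  proof -
    define a b where "a = \<bar>Re w\<bar> / d" and "b = \<bar>Im w\<bar> / d"
    have a: "a \<ge> 0" and b: "b \<ge> 1" using d w by (auto simp: a_def b_def)
    have "Re w ^ 2 = d\<^sup>2 * a\<^sup>2" "Im w ^ 2 = d\<^sup>2 * b\<^sup>2"
      using d by (simp_all add: a_def b_def power_divide)
    then have "(cmod w)\<^sup>2 = d\<^sup>2 * (a\<^sup>2 + b\<^sup>2)"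
      by (simp add: cmod_power2 distrib_left)
    then have eq: "d\<^sup>2 / (cmod w)\<^sup>2 = 1 / (a\<^sup>2 + b\<^sup>2)" using d by simp
    have "1 \<le> b\<^sup>2" using b by simp
    moreover have "0 \<le> (a - b)\<^sup>2" "0 \<le> (a - 1)\<^sup>2" "0 \<le> (b - 1)\<^sup>2" by simp_all
    \<comment> \<open>Expand the product, bound \<open>ab\<close>, \<open>a\<close> and
      \<open>b\<close> by half sums of squares, and absorb the constants by
      \<open>1 \<le> b^2\<close>.\<close>
    ultimately have "(1 + a) * (1 + b) \<le> 3 * (a\<^sup>2 + b\<^sup>2)"
      using zero_le_power2[of a] unfolding power2_diff ring_distribs mult_1_left mult_1_right one_power2 mult.assoc
      by linarith
    moreover have "0 < (1 + a) * (1 + b)" using a b by simp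
    ultimately have "3 / (3 * (a\<^sup>2 + b\<^sup>2)) \<le> 3 / ((1 + a) * (1 + b))"
      by (intro frac_le) auto
    then have "1 / (a\<^sup>2 + b\<^sup>2) \<le> 3 / ((1 + a) * (1 + b))"
      by (simp del: distrib_left_numeral)
    then show ?thesis unfolding eq a_def[symmetric] b_def[symmetric] by simp
  qed
  finally show ?thesis by simp
qed

text \<open>A cruder bound for rows passing within \<open>d\<close> of \<open>z\<close>, where
  comparison with logarithms gives no control; the constant is \<open>140 * 8\<close>.\<close>

lemma regularised_row_estimate_near:
  fixes \<kappa> w :: complex and d :: real
  assumes d: "d > 0"
    and far: "7 * d \<le> cmod w \<Longrightarrow> cmod (\<kappa> - 1 / w) \<le> 6 * d / (cmod w)\<^sup>2"
    and near: "cmod w \<le> 7 * d \<Longrightarrow> cmod \<kappa> \<le> 140 / d"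
  shows "cmod (d * \<kappa>) \<le> 1120 / (1 + \<bar>Re w\<bar> / d)"
proof (cases "7 * d \<le> cmod w")
  case True
  have w0: "cmod w > 0" using True d by linarith
  have "cmod \<kappa> \<le> cmod (\<kappa> - 1 / w) + cmod (1 / w)"
    using norm_triangle_ineq[of "\<kappa> - 1 / w" "1 / w"] by simp
  also have "\<dots> \<le> 6 * d / (cmod w)\<^sup>2 + 1 / cmod w"
    using far[OF True] by (simp add: norm_divide)
  also have "\<dots> \<le> 2 / cmod w"
    using True d w0 by (simp add: field_simps power2_eq_square)
  finally have "cmod (d * \<kappa>) \<le> d * (2 / cmod w)"
    using d unfolding norm_mult norm_of_real by (intro mult_mono) auto
  also have "\<dots> \<le> 1120 / (1 + \<bar>Re w\<bar> / d)"
  proof -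
    have "d + \<bar>Re w\<bar> \<le> 2 * cmod w" using abs_Re_le_cmod[of w] True d by linarith
    then have "4 / (2 * cmod w) \<le> 1120 / (d + \<bar>Re w\<bar>)"
      using d by (intro frac_le) auto
    then have "d * (2 / cmod w) \<le> d * (1120 / (d + \<bar>Re w\<bar>))"
      using d by (intro mult_left_mono) auto
    also have "\<dots> = 1120 / ((d + \<bar>Re w\<bar>) / d)" by simp
    also have "(d + \<bar>Re w\<bar>) / d = 1 + \<bar>Re w\<bar> / d" using d by (simp add: add_divide_distrib)
    finally show ?thesis .
  qed
  finally show ?thesis .
next
  case False
  have "cmod (d * \<kappa>) \<le> d * (140 / d)"
    using near False d unfolding norm_mult norm_of_real by (intro mult_mono) auto
  also have "\<dots> = 1120 / 8" using d by simp
  also have "\<dots> \<le> 1120 / (1 + \<bar>Re w\<bar> / d)"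
  proof (rule divide_left_mono)
    have "\<bar>Re w\<bar> \<le> 7 * d" using abs_Re_le_cmod[of w] False by linarith
    then show "1 + \<bar>Re w\<bar> / d \<le> 8" using d by (simp add: field_simps)
  next
    have "0 < 1 + \<bar>Re w\<bar> / d" using d by (simp add: add_pos_nonneg)
    then show "0 < 8 * (1 + \<bar>Re w\<bar> / d)" by simp
  qed simp
  finally show ?thesis .
qed

text \<open>The row sum imitates the integral of \<open>1 / (z - x - \<i> y)\<close> over
  \<open>-M \<le> x \<le> M\<close>. Its value splits into a part holomorphic for
  \<open>|z| < M\<close> and a jump \<open>- \<i> pi sgn (Im z - y)\<close>. The factor
  \<open>1 / (1 + b)\<close> makes the errors of all rows summable to a logarithm.\<close>

lemma regularised_row_sum:
  fixes \<kappa> :: "int \<Rightarrow> complex" and z :: complex and d M y :: real and N :: nat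
  assumes N: "N > 0" and M: "M > 0" and d: "d = M / N"
    and z: "cmod z \<le> M / 2" and y: "\<bar>y\<bar> \<le> M"
    and far: "\<And>j. 7 * d \<le> cmod (z - Complex (j * d) y) \<Longrightarrow>
       cmod (\<kappa> j - 1 / (z - Complex (j * d) y)) \<le> 6 * d / (cmod (z - Complex (j * d) y))\<^sup>2"
    and near: "\<And>j. cmod (z - Complex (j * d) y) \<le> 7 * d \<Longrightarrow> cmod (\<kappa> j) \<le> 140 / d"
  shows "cmod (d * (\<Sum>j\<in>{- int N..<int N}. \<kappa> j) -
           (Ln (M + z - \<i> * y) - Ln (M - z + \<i> * y) - \<i> * pi * sgn (Im z - y)))
         \<le> 21000 * (4 * harm (2 * N + 1)) / (1 + \<bar>Im z - y\<bar> / d)"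
proof -
  define B :: real where "B = 4 * harm (2 * N + 1)"
  define J where "J = {- int N..<int N}"
  define b where "b = \<bar>Im z - y\<bar> / d"
  define v where "v = z - \<i> * y"
  define w where "w = (\<lambda>j::int. z - Complex (j * d) y)"
  define \<Lambda> where "\<Lambda> = Ln (M + z - \<i> * y) - Ln (M - z + \<i> * y)"
  have d0: "d > 0" using N M d by simp
  have Nd: "N * d = M" using N d by simp
  have Re_w: "\<bar>Re (w j)\<bar> / d = \<bar>Re z / d - j\<bar>" for j
  proof -
    have "Re (w j) = (Re z / d - j) * d" using d0 by (simp add: w_def field_simps)
    then show ?thesis using d0 by (simp add: abs_mult)
  qed
  have far': "7 * d \<le> cmod (w j) \<Longrightarrow> cmod (\<kappa> j - 1 / w j) \<le> 6 * d / (cmod (w j))\<^sup>2"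
    and near': "cmod (w j) \<le> 7 * d \<Longrightarrow> cmod (\<kappa> j) \<le> 140 / d" for j
    unfolding w_def by (rule far, assumption) (rule near, assumption)
  have Im_w: "Im (w j) = Im z - y" for j by (simp add: w_def)
  have Re_z: "\<bar>Re z\<bar> \<le> M / 2" using abs_Re_le_cmod[of z] z by linarith
  have "\<bar>Re z / d\<bar> \<le> N"
    using Re_z M d0 Nd by (simp add: field_simps)
  from sum_inverse_dist_int_le_harm[OF this]
  have sumB: "(\<Sum>j\<in>J. 1 / (1 + \<bar>Re (w j)\<bar> / d)) \<le> B"
    unfolding Re_w B_def J_def .
  have "(1::real) = harm 1" by (simp add: harm_def)
  also have "\<dots> \<le> harm (2 * N + 1)" by (rule harm_mono) simp
  finally have B1: "1 \<le> B" by (simp add: B_def)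
  have b0: "b \<ge> 0" using d0 by (simp add: b_def)
  have "cmod (d * (\<Sum>j\<in>J. \<kappa> j) - (\<Lambda> - \<i> * pi * sgn (Im z - y))) \<le> 21000 * B / (1 + b)"
  proof (cases "d \<le> \<bar>Im z - y\<bar>")
    case True
    have "Im v \<noteq> 0" using True d0 by (auto simp: v_def)
    have "(\<Sum>j\<in>J. Ln (w j) - Ln (w j - d)) =
        (\<Sum>j\<in>J. (\<lambda>j::int. Ln (v - j * d)) j - (\<lambda>j::int. Ln (v - j * d)) (j + 1))"
    proof (intro sum.cong refl)
      fix j
      have "w j = v - j * d" "w j - d = v - (j + 1) * d"
        by (simp_all add: w_def v_def complex_eq_iff algebra_simps)
      then show "Ln (w j) - Ln (w j - d) =
          (\<lambda>j::int. Ln (v - j * d)) j - (\<lambda>j::int. Ln (v - j * d)) (j + 1)"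
        by (simp only: of_int_add of_int_1)
    qed
    also have "\<dots> = Ln (v - (- int N) * d) - Ln (v - int N * d)"
      unfolding J_def by (subst sum_int_telescope) auto
    also have "\<dots> = Ln (M + v) - Ln (v - M)"
    proof -
      have "complex_of_int (int N) * d = M" using Nd by (metis of_int_of_nat_eq of_real_mult of_real_of_nat_eq)
      then show ?thesis by (simp add: add.commute)
    qed
    \<comment> \<open>Reflection makes both logarithms holomorphic near \<open>K\<close> and
      isolates the jump.\<close>
    also have "Ln (v - M) = Ln (M - v) + \<i> * pi * sgn (Im v)"
      by (rule Ln_minus_real_shift[OF _ \<open>Im v \<noteq> 0\<close>]) (use Re_z M in \<open>auto simp: v_def\<close>)
    finally have tel: "(\<Sum>j\<in>J. Ln (w j) - Ln (w j - d)) = \<Lambda> - \<i> * pi * sgn (Im z - y)"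
      by (simp add: \<Lambda>_def v_def algebra_simps)
    have "d * (\<Sum>j\<in>J. \<kappa> j) - (\<Lambda> - \<i> * pi * sgn (Im z - y)) =
        (\<Sum>j\<in>J. d * \<kappa> j - (Ln (w j) - Ln (w j - d)))"
      unfolding tel[symmetric] by (simp add: sum_subtractf sum_distrib_left)
    also have "cmod \<dots> \<le> (\<Sum>j\<in>J. 21000 / (1 + b) * (1 / (1 + \<bar>Re (w j)\<bar> / d)))"
    proof (rule sum_norm_le)
      fix j
      have "cmod (d * \<kappa> j - (Ln (w j) - Ln (w j - d))) \<le>
          21000 / ((1 + \<bar>Re (w j)\<bar> / d) * (1 + \<bar>Im (w j)\<bar> / d))"
        using regularised_row_estimate_far[OF d0 far' near'] True by (simp only: Im_w)
      then show "cmod (d * \<kappa> j - (Ln (w j) - Ln (w j - d))) \<le>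
          21000 / (1 + b) * (1 / (1 + \<bar>Re (w j)\<bar> / d))"
        by (simp add: Im_w b_def mult.commute)
    qed
    also have "\<dots> = 21000 / (1 + b) * (\<Sum>j\<in>J. 1 / (1 + \<bar>Re (w j)\<bar> / d))"
      by (simp add: sum_distrib_left)
    also have "\<dots> \<le> 21000 / (1 + b) * B"
      using sumB b0 by (intro mult_left_mono) auto
    finally show ?thesis by simp
  next
    case False
    \<comment> \<open>At most the factor \<open>1 + b < 2\<close> is lost here, so it suffices to
      bound the three terms separately; \<open>B1\<close> absorbs the constants.\<close>
    then have "b < 1" using d0 by (simp add: b_def)
    have "cmod (d * (\<Sum>j\<in>J. \<kappa> j)) = cmod (\<Sum>j\<in>J. d * \<kappa> j)"
      by (simp add: sum_distrib_left)
    also have "\<dots> \<le> (\<Sum>j\<in>J. 1120 * (1 / (1 + \<bar>Re (w j)\<bar> / d)))"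
    proof (rule sum_norm_le)
      fix j
      have "cmod (d * \<kappa> j) \<le> 1120 / (1 + \<bar>Re (w j)\<bar> / d)"
        by (rule regularised_row_estimate_near[OF d0 far' near'])
      then show "cmod (d * \<kappa> j) \<le> 1120 * (1 / (1 + \<bar>Re (w j)\<bar> / d))" by simp
    qed
    also have "\<dots> \<le> 1120 * B"
      using sumB by (simp add: sum_distrib_left[symmetric] del: times_divide_eq_right)
    finally have 1: "cmod (d * (\<Sum>j\<in>J. \<kappa> j)) \<le> 1120 * B" .
    have "cmod \<Lambda> \<le> cmod ((M + z - \<i> * y) - (M - z + \<i> * y)) / (M / 2)"
      unfolding \<Lambda>_def by (rule Ln_diff_right_half_plane) (use Re_z M in auto)
    also have "\<dots> \<le> 3 * M / (M / 2)"
    proof (rule divide_right_mono)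
      have "(M + z - \<i> * y) - (M - z + \<i> * y) = 2 * (z - \<i> * y)" by simp
      then show "cmod ((M + z - \<i> * y) - (M - z + \<i> * y)) \<le> 3 * M"
        using norm_triangle_ineq4[of z "\<i> * y"] z y
        by (simp add: norm_mult del: right_diff_distrib_numeral)
    qed (use M in auto)
    also have "\<dots> = 6" using M by simp
    finally have 2: "cmod \<Lambda> \<le> 6" .
    have 3: "cmod (\<i> * pi * sgn (Im z - y)) \<le> 4"
      using pi_less_4 by (simp add: norm_mult sgn_if)
    have "cmod (d * (\<Sum>j\<in>J. \<kappa> j) - (\<Lambda> - \<i> * pi * sgn (Im z - y))) \<le> 1120 * B + (6 + 4)"
      using norm_triangle_ineq4[of "d * (\<Sum>j\<in>J. \<kappa> j)" "\<Lambda> - \<i> * pi * sgn (Im z - y)"]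
        norm_triangle_ineq4[of \<Lambda> "\<i> * pi * sgn (Im z - y)"] 1 2 3 by linarith
    also have "\<dots> \<le> 21000 * B / 2" using B1 by simp
    also have "\<dots> \<le> 21000 * B / (1 + b)"
      using b0 \<open>b < 1\<close> B1 by (intro divide_left_mono) auto
    finally show ?thesis .
  qed
  then show ?thesis by (simp add: B_def J_def b_def \<Lambda>_def)
qed

subsection \<open>Lavrentiev's theorem\<close>

text \<open>For \<open>|z| < M\<close> both arguments have positive real part, and \<open>K\<close>
  lies in the disc of half that radius.\<close>

lemma poly_approximable_Ln_linear:
  assumes "compact K" "\<And>z. z \<in> K \<Longrightarrow> cmod z \<le> M / 2" "M > 0"
  shows "poly_approximable K (\<lambda>z. Ln (M + z - \<i> * of_real y))"
    and "poly_approximable K (\<lambda>z. Ln (M - z + \<i> * of_real y))"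
proof -
  have *: "M + z - \<i> * of_real y \<notin> \<real>\<^sub>\<le>\<^sub>0" "M - z + \<i> * of_real y \<notin> \<real>\<^sub>\<le>\<^sub>0"
    if "z \<in> ball 0 M" for z :: complex
    using that abs_Re_le_cmod[of z] by (auto simp: complex_nonpos_Reals_iff)
  have hol: "(\<lambda>z. Ln (M + z - \<i> * of_real y)) holomorphic_on ball 0 M"
    "(\<lambda>z. Ln (M - z + \<i> * of_real y)) holomorphic_on ball 0 M"
    by (intro holomorphic_intros; use * in blast)+
  show "poly_approximable K (\<lambda>z. Ln (M + z - \<i> * of_real y))"
    by (rule poly_approximable_holomorphic_compose[OF assms(1) poly_approximable_ident hol(1), of "M / 2"])
       (use assms in auto)
  show "poly_approximable K (\<lambda>z. Ln (M - z + \<i> * of_real y))"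
    by (rule poly_approximable_holomorphic_compose[OF assms(1) poly_approximable_ident hol(2), of "M / 2"])
       (use assms in auto)
qed

text \<open>Summing the rows, with the holomorphic parts removed, gives \<open>G\<close> close to
  \<open>- \<i> pi\<close> times the sum of \<open>d sgn (Im z - l d)\<close>, hence close to
  \<open>- 2 pi \<i> Im z\<close>. One factor \<open>B\<close> comes from the row estimate, the
  other from summing over rows; \<open>8 d\<close> bounds \<open>pi\<close> times the rounding error
  of the sign sum.\<close>

lemma poly_approximable_Im_grid:
  fixes M d :: real and N :: nat
  assumes K: "compact K" "connected (- K)" "interior K = {}"
    and M: "M > 0" "\<And>z. z \<in> K \<Longrightarrow> cmod z \<le> M / 2" and N: "N > 0" and d: "d = M / N"
  shows "\<exists>g. poly_approximable K g \<and>
           (\<forall>z\<in>K. cmod (g z - of_real (Im z)) \<le> 21000 * d * (4 * harm (2 * N + 1))\<^sup>2 + 8 * d)"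
proof -
  define J where "J = {- int N..<int N}"
  define B :: real where "B = 4 * harm (2 * N + 1)"
  have d0: "d > 0" using M N d by simp
  have Nd: "N * d = M" using N d by simp
  have "\<forall>c. \<exists>k. poly_approximable K k \<and>
           (\<forall>z\<in>K. (7 * d \<le> cmod (z - c) \<longrightarrow> cmod (k z - 1 / (z - c)) \<le> 6 * d / (cmod (z - c))\<^sup>2) \<and>
                  (cmod (z - c) \<le> 7 * d \<longrightarrow> cmod (k z) \<le> 140 / d))"
    using exists_regularised_pole[OF K d0] by blast
  then obtain k where k: "\<And>c. poly_approximable K (k c)"
    and far: "\<And>c z. z \<in> K \<Longrightarrow> 7 * d \<le> cmod (z - c) \<Longrightarrow> cmod (k c z - 1 / (z - c)) \<le> 6 * d / (cmod (z - c))\<^sup>2"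
    and near: "\<And>c z. z \<in> K \<Longrightarrow> cmod (z - c) \<le> 7 * d \<Longrightarrow> cmod (k c z) \<le> 140 / d"
    by metis
  define \<Lambda> where "\<Lambda> = (\<lambda>(l::int) (z::complex). Ln (M + z - \<i> * of_real (l * d)) - Ln (M - z + \<i> * of_real (l * d)))"
  define R where "R = (\<lambda>(l::int) (z::complex). d * (\<Sum>j\<in>J. k (Complex (j * d) (l * d)) z) - \<Lambda> l z)"
  define G where "G = (\<lambda>z. \<Sum>l\<in>J. d * R l z)"
  \<comment> \<open>The factor is the inverse of \<open>- 2 pi \<i>\<close>.\<close>
  define g where "g = (\<lambda>z. \<i> / (2 * pi) * G z)"
  have "poly_approximable K g"
    unfolding g_def G_def R_def \<Lambda>_def
    by (rule poly_approximable_cmult[OF K(1)], rule poly_approximable_sum,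
        rule poly_approximable_cmult[OF K(1)], rule poly_approximable_diff[OF K(1)],
        rule poly_approximable_cmult[OF K(1)], rule poly_approximable_sum, rule k,
        rule poly_approximable_diff[OF K(1)],
        rule poly_approximable_Ln_linear(1)[OF K(1) M(2,1)], assumption,
        rule poly_approximable_Ln_linear(2)[OF K(1) M(2,1)], assumption)
  moreover have "cmod (g z - of_real (Im z)) \<le> 21000 * d * B\<^sup>2 + 8 * d" if z: "z \<in> K" for z
  proof -
    have zM: "cmod z \<le> M / 2" by (rule M(2)[OF z])
    then have Im_z: "\<bar>Im z\<bar> \<le> M / 2" using abs_Im_le_cmod[of z] by linarith
    define s where "s = (\<Sum>l\<in>J. d * sgn (Im z - l * d))"
    have row: "cmod (R l z + \<i> * pi * sgn (Im z - l * d)) \<le> 21000 * B / (1 + \<bar>Im z - l * d\<bar> / d)"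
      if l: "l \<in> J" for l
    proof -
      have "\<bar>real_of_int l\<bar> \<le> real N" using l by (auto simp: J_def)
      then have "\<bar>real_of_int l * d\<bar> \<le> M"
        using d0 Nd by (metis abs_mult abs_of_pos mult_le_cancel_right_pos)
      from regularised_row_sum[OF N M(1) d zM this, of "\<lambda>j. k (Complex (j * d) (l * d)) z"]
      show ?thesis
        using far[OF z] near[OF z] by (simp add: R_def \<Lambda>_def J_def B_def algebra_simps)
    qed
    have "\<bar>Im z / d\<bar> < N" using Im_z Nd d0 M(1) by (simp add: field_simps)
    have scale: "Im z - real_of_int l * d = (Im z / d - l) * d" for l
      using d0 by (simp add: algebra_simps)
    have "G z + \<i> * pi * s = (\<Sum>l\<in>J. d * (R l z + \<i> * pi * sgn (Im z - l * d)))"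
      by (simp add: G_def s_def sum.distrib sum_distrib_left algebra_simps)
    also have "cmod \<dots> \<le> (\<Sum>l\<in>J. d * (21000 * B) * (1 / (1 + \<bar>Im z / d - l\<bar>)))"
    proof (rule sum_norm_le)
      fix l assume "l \<in> J"
      from mult_left_mono[OF row[OF this], of d] d0
      show "cmod (d * (R l z + \<i> * pi * sgn (Im z - l * d))) \<le>
          d * (21000 * B) * (1 / (1 + \<bar>Im z / d - l\<bar>))"
        unfolding scale by (simp add: norm_mult abs_mult)
    qed
    also have "\<dots> = d * (21000 * B) * (\<Sum>l\<in>J. 1 / (1 + \<bar>Im z / d - l\<bar>))"
      by (simp only: sum_distrib_left)
    also have "\<dots> \<le> d * (21000 * B) * B"
    proof (rule mult_left_mono)
      show "(\<Sum>l\<in>J. 1 / (1 + \<bar>Im z / d - l\<bar>)) \<le> B"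
        unfolding J_def B_def
        by (rule sum_inverse_dist_int_le_harm) (use \<open>\<bar>Im z / d\<bar> < N\<close> in simp)
      show "0 \<le> d * (21000 * B)" using d0 harm_nonneg[of "2 * N + 1", where 'a = real] by (simp add: B_def)
    qed
    finally have 1: "cmod (G z + \<i> * pi * s) \<le> 21000 * d * B\<^sup>2"
      by (simp add: power2_eq_square)
    have "s = d * (\<Sum>l\<in>J. sgn (Im z / d - l))"
      unfolding s_def scale sum_distrib_left using d0 by (intro sum.cong refl) (simp add: sgn_mult)
    then have "s - 2 * Im z = d * ((\<Sum>l\<in>J. sgn (Im z / d - l)) - 2 * (Im z / d))"
      using d0 by (simp add: algebra_simps)
    then have 2: "\<bar>s - 2 * Im z\<bar> \<le> d * 2"
      using sum_sgn_diff_int[OF \<open>\<bar>Im z / d\<bar> < N\<close>] d0 by (simp add: abs_mult J_def)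
    have "G z + 2 * pi * \<i> * Im z = (G z + \<i> * pi * s) - \<i> * pi * (s - 2 * Im z)"
      by (simp add: algebra_simps)
    then have "cmod (G z + 2 * pi * \<i> * Im z) \<le> cmod (G z + \<i> * pi * s) + cmod (\<i> * pi * (s - 2 * Im z))"
      by (metis norm_triangle_ineq4)
    also have "cmod (\<i> * pi * (s - 2 * Im z)) = pi * \<bar>s - 2 * Im z\<bar>"
    proof -
      have "complex_of_real s - 2 * of_real (Im z) = of_real (s - 2 * Im z)" by simp
      then show ?thesis by (simp only: norm_mult norm_of_real norm_ii) simp
    qed
    also have "pi * \<bar>s - 2 * Im z\<bar> \<le> 4 * (d * 2)"
      using 2 pi_less_4 by (intro mult_mono) auto
    finally have 3: "cmod (G z + 2 * pi * \<i> * Im z) \<le> 21000 * d * B\<^sup>2 + 8 * d" using 1 by simp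
    have "g z - of_real (Im z) = \<i> / (2 * pi) * (G z + 2 * pi * \<i> * Im z)"
      by (simp add: g_def field_simps)
    then have "cmod (g z - of_real (Im z)) = 1 / (2 * pi) * cmod (G z + 2 * pi * \<i> * Im z)"
      by (simp only: norm_mult norm_divide norm_ii norm_of_real) simp
    also have "\<dots> \<le> 1 * cmod (G z + 2 * pi * \<i> * Im z)"
      using pi_gt3 by (intro mult_right_mono) auto
    finally show ?thesis using 3 by simp
  qed
  ultimately show ?thesis unfolding B_def by blast
qed

lemma poly_approximable_Im:
  assumes K: "compact K" "connected (- K)" "interior K = {}"
  shows "poly_approximable K (\<lambda>z. of_real (Im z))"
proof (rule poly_approximable_limit)
  fix e :: real assume e: "e > 0"
  obtain B where B: "B > 0" "\<forall>z\<in>K. cmod z \<le> B"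
    using compact_imp_bounded[OF K(1)] by (auto simp: bounded_pos)
  define M where "M = 2 * B"
  have M: "M > 0" "\<And>z. z \<in> K \<Longrightarrow> cmod z \<le> M / 2" using B by (auto simp: M_def)
  \<comment> \<open>The grid error with the harmonic number replaced by its bound
    \<open>1 + ln\<close>; it is of order \<open>(ln N)^2 / N\<close>.\<close>
  define E where "E = (\<lambda>N::nat. 21000 * (M / real N) * (4 * (1 + ln (2 * real N + 1)))\<^sup>2 + 8 * (M / real N))"
  have "E \<longlonglongrightarrow> 0" unfolding E_def by real_asymp
  from order_tendstoD(2)[OF this e] eventually_gt_at_top[of 0]
  have "\<forall>\<^sub>F N in sequentially. N > 0 \<and> E N < e" by eventually_elim simp
  from eventually_happens'[OF sequentially_bot this] obtain N where N: "N > 0" "E N < e" by blast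
  have "harm (2 * N + 1) - ln (real (2 * N + 1)) \<le> harm 1 - ln (real 1)"
    by (rule euler_mascheroni_sequence_decreasing) auto
  then have "harm (2 * N + 1) \<le> 1 + ln (2 * real N + 1)" by (simp add: harm_def add.commute)
  then have "(4 * harm (2 * N + 1))\<^sup>2 \<le> (4 * (1 + ln (2 * real N + 1)))\<^sup>2"
    by (intro power_mono mult_left_mono) (auto simp: harm_nonneg)
  then have "21000 * (M / N) * (4 * harm (2 * N + 1))\<^sup>2 \<le> 21000 * (M / N) * (4 * (1 + ln (2 * real N + 1)))\<^sup>2"
    using M by (intro mult_left_mono) auto
  then have "21000 * (M / N) * (4 * harm (2 * N + 1))\<^sup>2 + 8 * (M / N) \<le> e"
    using N(2) unfolding E_def by linarith
  with poly_approximable_Im_grid[OF K M N(1) refl]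
  show "\<exists>g. poly_approximable K g \<and> (\<forall>z\<in>K. cmod (g z - of_real (Im z)) \<le> e)"
    by (meson order_trans)
qed

text \<open>Once \<open>Im z\<close> is in the algebra, so is \<open>Re z = z - \<i> Im z\<close>,
  hence every real polynomial in the two coordinates; Stone-Weierstrass then handles the real and
  imaginary parts of \<open>f\<close>.\<close>

theorem Lavrentiev:
  assumes K: "compact K" "connected (- K)" "interior K = {}" and f: "continuous_on K f"
  shows "poly_approximable K f"
proof -
  have Im: "poly_approximable K (\<lambda>z. of_real (Im z))" by (rule poly_approximable_Im[OF K])
  have "poly_approximable K (\<lambda>z. z - \<i> * of_real (Im z))"
    by (rule poly_approximable_diff[OF K(1) poly_approximable_ident poly_approximable_cmult[OF K(1) Im]])
  then have Re: "poly_approximable K (\<lambda>z. of_real (Re z))"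
    by (rule poly_approximable_cong) (simp add: complex_eq_iff)
  have poly: "poly_approximable K (\<lambda>z. of_real (h z))" if "real_polynomial_function h" for h
    using that
  proof (induction rule: real_polynomial_function.induct)
    case (linear h)
    then interpret bounded_linear h .
    \<comment> \<open>Real polynomial functions are generated by arbitrary bounded linear
      functionals, which on the complex plane are combinations of \<open>Re\<close> and
      \<open>Im\<close>.\<close>
    have hz: "h z = Re z * h 1 + Im z * h \<i>" for z
    proof -
      have "z = Re z *\<^sub>R 1 + Im z *\<^sub>R \<i>" by (simp add: complex_eq_iff)
      then have "h z = h (Re z *\<^sub>R 1 + Im z *\<^sub>R \<i>)" by (rule arg_cong)
      also have "\<dots> = Re z * h 1 + Im z * h \<i>" by (simp only: add scaleR real_scaleR_def)
      finally show ?thesis .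
    qed
    have eq: "(\<lambda>z. complex_of_real (h z)) = (\<lambda>z. of_real (h 1) * of_real (Re z) + of_real (h \<i>) * of_real (Im z))"
      by (rule ext, subst hz) simp
    show ?case
      unfolding eq
      by (rule poly_approximable_add[OF poly_approximable_cmult[OF K(1) Re] poly_approximable_cmult[OF K(1) Im]])
  next
    case (const c)
    show ?case by (rule poly_approximable_const)
  next
    case (add h1 h2)
    from poly_approximable_add[OF add.IH] show ?case by simp
  next
    case (mult h1 h2)
    from poly_approximable_mult[OF K(1) mult.IH] show ?case by simp
  qed
  have real: "poly_approximable K (\<lambda>z. of_real (u z))" if "continuous_on K u" for u
  proof (rule poly_approximable_limit)
    fix e :: real assume "e > 0"
    from Stone_Weierstrass_real_polynomial_function[OF K(1) that this]
    obtain h where h: "real_polynomial_function h" "\<And>x. x \<in> K \<Longrightarrow> \<bar>u x - h x\<bar> < e" by blast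
    have "cmod (of_real (h z) - of_real (u z)) \<le> e" if "z \<in> K" for z
      using h(2)[OF that] by (metis abs_minus_commute less_imp_le norm_of_real of_real_diff)
    then show "\<exists>g. poly_approximable K g \<and> (\<forall>z\<in>K. cmod (g z - of_real (u z)) \<le> e)"
      using poly[OF h(1)] by blast
  qed
  have "poly_approximable K (\<lambda>z. of_real (Re (f z)) + \<i> * of_real (Im (f z)))"
    by (rule poly_approximable_add[OF real[OF continuous_on_Re[OF f]]
          poly_approximable_cmult[OF K(1) real[OF continuous_on_Im[OF f]]]])
  then show ?thesis by (rule poly_approximable_cong) (simp add: complex_eq_iff)
qed

section \<open>Moving zeros off the compact set\<close>

text \<open>Induction on the degree: split off a root \<open>a\<close>, perturb the cofactor, and
  replace \<open>a\<close> by a nearby \<open>a'\<close> outside \<open>K\<close>, which exists as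
  \<open>K\<close> contains no disc.\<close>

lemma nonvanishing_poly_approximation:
  fixes p :: "complex poly"
  assumes K: "compact K" "interior K = {}" and "e > 0"
  shows "\<exists>q. (\<forall>z\<in>K. poly q z \<noteq> 0) \<and> (\<forall>z\<in>K. cmod (poly q z - poly p z) < e)"
  using \<open>e > 0\<close>
proof (induction "degree p" arbitrary: p e)
  case 0
  then obtain a where a: "p = [:a:]" by (metis degree_eq_zeroE)
  define b where "b = (if a = 0 then of_real (e / 2) else a)"
  have "b \<noteq> 0" "cmod (b - a) < e" using 0 by (auto simp: b_def)
  then show ?case by (intro exI[of _ "[:b:]"]) (auto simp: a)
next
  case (Suc n)
  obtain a where "poly p a = 0"
    using Suc(2) Fundamental_Theorem_Algebra.fundamental_theorem_of_algebra[of p] by (auto simp: constant_degree)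
  then obtain p' where p': "p = [:- a, 1:] * p'" by (auto simp: poly_eq_0_iff_dvd elim: dvdE)
  have "p' \<noteq> 0" using p' Suc(2) by auto
  then have "degree p = Suc (degree p')"
    unfolding p' by (subst degree_mult_eq) auto
  then have n: "n = degree p'" using Suc(2) by simp
  obtain B where B: "B > 0" "\<forall>z\<in>K. cmod (z - a) \<le> B"
    using poly_approximable_bounded[OF K(1) poly_approximable_poly[of _ "[:- a, 1:]"]] by auto
  have "e / (2 * B) > 0" using Suc B by simp
  from Suc(1)[OF n this] obtain q' where q': "\<forall>z\<in>K. poly q' z \<noteq> 0"
    "\<forall>z\<in>K. cmod (poly q' z - poly p' z) < e / (2 * B)" by blast
  \<comment> \<open>The root is moved only after \<open>q'\<close> is fixed, as the permitted
    displacement depends on the bound \<open>C\<close> for \<open>q'\<close>; each perturbation then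
    costs less than \<open>e / 2\<close>.\<close>
  obtain C where C: "C > 0" "\<forall>z\<in>K. cmod (poly q' z) \<le> C"
    using poly_approximable_bounded[OF K(1) poly_approximable_poly] by blast
  have "\<not> ball a (e / (2 * C)) \<subseteq> K"
  proof
    assume "ball a (e / (2 * C)) \<subseteq> K"
    then have "ball a (e / (2 * C)) \<subseteq> interior K" by (simp add: interior_maximal)
    moreover have "e / (2 * C) > 0" using Suc(3) C by simp
    ultimately show False using K(2) by simp
  qed
  then obtain a' where a': "a' \<notin> K" "cmod (a - a') < e / (2 * C)" by (auto simp: subset_iff dist_norm)
  have "poly ([:- a', 1:] * q') z \<noteq> 0" if "z \<in> K" for z
    using q'(1) a'(1) that by auto
  moreover have "cmod (poly ([:- a', 1:] * q') z - poly p z) < e" if z: "z \<in> K" for z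
  proof -
    have "poly ([:- a', 1:] * q') z - poly p z = (a - a') * poly q' z + (z - a) * (poly q' z - poly p' z)"
      by (simp add: p' algebra_simps)
    then have "cmod (poly ([:- a', 1:] * q') z - poly p z) \<le>
        cmod (a - a') * cmod (poly q' z) + cmod (z - a) * cmod (poly q' z - poly p' z)"
      by (metis norm_mult norm_triangle_ineq)
    also have "\<dots> \<le> cmod (a - a') * C + B * cmod (poly q' z - poly p' z)"
      using z B C by (intro add_mono mult_left_mono mult_right_mono) auto
    also have "\<dots> < e / (2 * C) * C + B * (e / (2 * B))"
      using z B C a' q' by (intro add_strict_mono mult_strict_left_mono mult_strict_right_mono) auto
    also have "\<dots> = e" using B C by (simp add: field_simps)
    finally show ?thesis .
  qed
  ultimately show ?case by blast
qed

theorem theorem1: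
  fixes K :: "complex set" and f :: "complex \<Rightarrow> complex"
  assumes "compact K"
    and "connected (UNIV - K)"
    and "interior K = {}"
    and "continuous_on K f"
  shows "\<forall>\<epsilon>::real. \<epsilon> > 0 \<longrightarrow>
    (\<exists>p :: complex poly. (\<forall>z\<in>K. poly p z \<noteq> 0) \<and> (\<forall>z\<in>K. cmod (poly p z - f z) < \<epsilon>))"
proof (intro allI impI)
  fix \<epsilon> :: real assume \<epsilon>: "\<epsilon> > 0"
  have "connected (- K)" using assms(2) by (simp add: Compl_eq_Diff_UNIV)
  from Lavrentiev[OF assms(1) this assms(3,4)] \<epsilon>
  obtain q :: "complex poly" where q: "\<forall>z\<in>K. cmod (poly q z - f z) < \<epsilon> / 2"
    unfolding poly_approximable_def by (meson half_gt_zero)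
  obtain p where p: "\<forall>z\<in>K. poly p z \<noteq> 0" "\<forall>z\<in>K. cmod (poly p z - poly q z) < \<epsilon> / 2"
    using nonvanishing_poly_approximation[OF assms(1,3), of "\<epsilon> / 2" q] \<epsilon> by auto
  have "cmod (poly p z - f z) < \<epsilon>" if "z \<in> K" for z
    using p(2) q that norm_triangle_ineq[of "poly p z - poly q z" "poly q z - f z"] by fastforce
  with p(1) show "\<exists>p. (\<forall>z\<in>K. poly p z \<noteq> 0) \<and> (\<forall>z\<in>K. cmod (poly p z - f z) < \<epsilon>)"
    by blast
qed

end
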